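(* Let $M\ge 1$ be an integer, let $\beta_1,\dots,\beta_M$ be the coefficients of the $M$-step Adams--Bashforth scheme, and for $N\ge M$ let $B_h\in\mathbb{R}^{(N-M+1)\times N}$ be its non-auxiliary discovery matrix. (i) If $M=1$, then $\ker(B_h)=\{0\}$. (ii) Let $M\ge 2$ and suppose that $$\rho_{\rm AB}:=\max\{|\lambda|:\lambda\in\mathbb{C},\ p_{\rm AB}(\lambda)=0\}<1,\qquad p_{\rm AB}(z)=\beta_1z^{M-1}+\beta_2z^{M-2}+\cdots+\beta_{M-1}z+\beta_M .$$ Then, for every $\theta\in(\rho_{\rm AB},1)$, there exists a constant $C>0$, independent of $N$, such that every $d=(d_0,\ldots,d_{N-1})^\top\in\ker(B_h)$ satisfies $$|d_i|\le C\,\theta^i\sum_{j=0}^{M-2}|d_j|,\qquad i=0,\ldots,N-1.$$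
   Context: The $M$-step Adams--Bashforth (A-B) scheme for $\dot x=f$ on a uniform grid of step $h$ is the classical explicit linear multistep method $x_n-x_{n-1}=h\sum_{m=1}^M\beta_m f_{n-m}$ (so $\alpha_0=1$, $\alpha_1=-1$, the other $\alpha_m=0$, and $\beta_0=0$), with real coefficients $$\beta_m=\frac{(-1)^{m-1}}{(m-1)!\,(M-m)!}\int_0^1\prod_{i=0,\ i\ne m-1}^{M-1}(u+i)\,du,\qquad m=1,\dots,M;$$ in particular $\beta_1\neq0$. Non-auxiliary A-B discovery matrix: for $N\ge M$, $B_h\in\mathbb{R}^{(N-M+1)\times N}$ acts on $d=(d_0,\ldots,d_{N-1})^\top\in\mathbb{R}^N$ by $(B_hd)_n=\sum_{m=1}^M\beta_m d_{n-m}$, the rows being indexed by $n=M,\ldots,N$. Hence $d\in\ker(B_h)$ if and only if $\sum_{m=1}^M\beta_m d_{n-m}=0$ for all $n=M,\ldots,N$. (The entries of $B_h$ do not depend on $h$; only its size depends on $N$.) *)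

theory Defs
  imports
    "HOL-Analysis.Henstock_Kurzweil_Integration"
    "HOL-Computational_Algebra.Polynomial"
    "Jordan_Normal_Form.Matrix_Kernel"
begin

definition AB_coeff :: "nat \<Rightarrow> nat \<Rightarrow> real" where
  "AB_coeff M m =
     (-1) ^ (m - 1) / (fact (m - 1) * fact (M - m)) *
     integral {0..1} (\<lambda>u::real. \<Prod>i\<in>{0..<M} - {m - 1}. u + real i)"

text \<open>
  The coefficients are meant for \<open>1 \<le> m \<le> M\<close>.
  Matrix rows are counted from 0, so row \<open>r\<close> is the equation for \<open>n = M + r\<close>,
  where \<open>n = M, \<dots>, N\<close>; its entry in column \<open>c\<close> is \<open>\<beta>\<^sub>n\<^sub>-\<^sub>c\<close> if \<open>1 \<le> n - c \<le> M\<close>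
  (that is, \<open>r \<le> c < M + r\<close>) and 0 otherwise.  The entries do not depend on the step size
  \<open>h\<close>, which is therefore not a parameter.
\<close>

definition AB_matrix :: "nat \<Rightarrow> nat \<Rightarrow> real mat" where
  "AB_matrix M N =
     mat (N - M + 1) N
       (\<lambda>(r, c). if r \<le> c \<and> c < M + r then AB_coeff M (M + r - c) else 0)"

definition AB_poly :: "nat \<Rightarrow> complex poly" where
  "AB_poly M = (\<Sum>m = 1..M. monom (complex_of_real (AB_coeff M m)) (M - m))"

text \<open>
  Used only for \<open>M \<ge> 2\<close>, where \<open>AB_poly M\<close> has degree \<open>M - 1 \<ge> 1\<close> because \<open>\<beta>\<^sub>1 \<noteq> 0\<close>, so
  that the maximum is over a finite nonempty set.
\<close>

definition AB_rho :: "nat \<Rightarrow> real" where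
  "AB_rho M = Max {cmod z | z. poly (AB_poly M) z = 0}"

lemma AB_matrix_mult_vec:
  assumes "M \<le> N" "d \<in> carrier_vec N" "n \<in> {M..N}"
  shows "vec_index (AB_matrix M N *\<^sub>v d) (n - M) =
           (\<Sum>m = 1..M. AB_coeff M m * vec_index d (n - m))"
proof -
  have "vec_index (AB_matrix M N *\<^sub>v d) (n - M) =
      (\<Sum>c = 0..<N. (if n - M \<le> c \<and> c < n then AB_coeff M (n - c) else 0) * vec_index d c)"
    using assms by (auto simp: AB_matrix_def scalar_prod_def intro!: sum.cong)
  also have "\<dots> = (\<Sum>c \<in> {n - M..<n}. AB_coeff M (n - c) * vec_index d c)"
    using assms by (intro sum.mono_neutral_cong_right) auto
  also have "\<dots> = (\<Sum>m = 1..M. AB_coeff M m * vec_index d (n - m))"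
    using assms by (intro sum.reindex_bij_witness[of _ "\<lambda>m. n - m" "\<lambda>c. n - c"]) auto
  finally show ?thesis .
qed

end

theory Submission
  imports Defs "HOL-Computational_Algebra.Fundamental_Theorem_Algebra"
begin

text \<open>
  A vector lies in the kernel of the Adams--Bashforth discovery matrix exactly when its entries
  satisfy a homogeneous linear recurrence whose characteristic polynomial is \<open>AB_poly M\<close>.  Because
  \<open>\<beta>\<^sub>1 \<noteq> 0\<close> (\<open>AB_coeff_1_pos\<close>), this polynomial has degree \<open>M - 1\<close>, so the recurrence determines
  every entry from the first \<open>M - 1\<close> ones; if \<open>M = 1\<close> nothing is left to prescribe, and the kernel is
  trivial.

  The decay estimate holds for every complex linear recurrence whose characteristic roots have modulus
  less than \<open>\<theta>\<close> (\<open>recurrence_decay\<close>).  With \<open>E\<close> the shift of sequences, the recurrence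
  reads \<open>p(E) x = 0\<close>.  Splitting off one root, \<open>p(z) = (z - \<lambda>) q(z)\<close>, the sequence
  \<open>y = (E - \<lambda>) x\<close> satisfies the shorter recurrence \<open>q(E) y = 0\<close>, hence decays like \<open>\<theta>\<^sup>i\<close> by induction
  on the degree; and \<open>x\<close> is recovered from \<open>y\<close> by the first-order equation
  \<open>x\<^sub>i\<^sub>+\<^sub>1 = \<lambda> x\<^sub>i + y\<^sub>i\<close>, which preserves decay of order \<open>\<theta>\<^sup>i\<close> because \<open>\<bar>\<lambda>\<bar> < \<theta>\<close>
  (\<open>first_order_decay\<close>).  Removing the roots one at a time treats multiple roots like simple ones,
  and all constants depend only on \<open>p\<close> and \<open>\<theta>\<close>, never on the length \<open>N\<close>.
\<close>

section \<open>Decay of solutions of linear recurrences\<close>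

text \<open>
  This is \<open>p(E) x\<close>, where \<open>E\<close> is the shift \<open>x \<mapsto> (\<lambda>n. x (n + 1))\<close>, so that factoring \<open>p\<close>
  composes operators.
\<close>

definition shift_op :: "'a::comm_ring_1 poly \<Rightarrow> (nat \<Rightarrow> 'a) \<Rightarrow> nat \<Rightarrow> 'a" where
  "shift_op p x n = (\<Sum>k\<le>degree p. coeff p k * x (n + k))"

lemma shift_op_bound:
  assumes "degree p \<le> K"
  shows "shift_op p x n = (\<Sum>k\<le>K. coeff p k * x (n + k))"
  unfolding shift_op_def using assms
  by (intro sum.mono_neutral_left) (auto simp: coeff_eq_0)

lemma shift_op_linear_factor:
  "shift_op ([:- l, 1:] * q) x = shift_op q (\<lambda>n. x (Suc n) - l * x n)"
proof
  fix n
  let ?K = "degree q"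
  have "degree ([:- l, 1:] * q) \<le> Suc ?K"
    by (rule order_trans[OF degree_mult_le]) simp
  then have "shift_op ([:- l, 1:] * q) x n =
      (\<Sum>k\<le>Suc ?K. coeff (pCons 0 q) k * x (n + k)) - (\<Sum>k\<le>Suc ?K. l * coeff q k * x (n + k))"
    by (simp add: shift_op_bound algebra_simps sum_subtractf del: sum.atMost_Suc)
  also have "(\<Sum>k\<le>Suc ?K. coeff (pCons 0 q) k * x (n + k)) = (\<Sum>k\<le>?K. coeff q k * x (Suc (n + k)))"
    by (subst sum.atMost_Suc_shift) simp
  also have "(\<Sum>k\<le>Suc ?K. l * coeff q k * x (n + k)) = (\<Sum>k\<le>?K. l * coeff q k * x (n + k))"
    by (simp add: coeff_eq_0)
  finally show "shift_op ([:- l, 1:] * q) x n = shift_op q (\<lambda>n. x (Suc n) - l * x n) n"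
    by (simp add: shift_op_def algebra_simps sum_subtractf)
qed

text \<open>
  The constant \<open>K = 1 + A / (\<theta> - \<bar>l\<bar>)\<close> satisfies \<open>\<bar>l\<bar> K + A \<le> \<theta> K\<close>, so the bound
  \<open>K \<theta>\<^sup>i S\<close> passes from \<open>i\<close> to \<open>i + 1\<close>; the summand 1 makes it hold at \<open>i = 0\<close>.
\<close>

lemma first_order_decay:
  fixes x :: "nat \<Rightarrow> 'a::real_normed_field"
  assumes l: "norm l < \<theta>" and A: "A \<ge> 0" and x0: "norm (x 0) \<le> S"
    and y: "\<And>i. Suc i < N \<Longrightarrow> norm (x (Suc i) - l * x i) \<le> A * \<theta> ^ i * S"
    and i: "i < N"
  shows "norm (x i) \<le> (1 + A / (\<theta> - norm l)) * \<theta> ^ i * S"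
  using i
proof (induction i)
  have S: "S \<ge> 0" using x0 norm_ge_zero order_trans by blast
  case 0
  have "0 \<le> A / (\<theta> - norm l)" using A l by simp
  then have "1 * S \<le> (1 + A / (\<theta> - norm l)) * S" using S by (intro mult_right_mono) auto
  then show ?case using x0 by simp
next
  case (Suc i)
  define K where "K = 1 + A / (\<theta> - norm l)"
  have S: "S \<ge> 0" using x0 norm_ge_zero order_trans by blast
  have \<theta>: "\<theta> > 0" using l norm_ge_zero[of l] by linarith
  have "A = (K - 1) * (\<theta> - norm l)" using l by (simp add: K_def)
  then have K_step: "norm l * K + A \<le> \<theta> * K" using l by (simp add: algebra_simps)
  have "norm (x (Suc i)) = norm (l * x i + (x (Suc i) - l * x i))" by simp
  also have "\<dots> \<le> norm l * norm (x i) + norm (x (Suc i) - l * x i)"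
    by (metis norm_mult norm_triangle_ineq)
  also have "\<dots> \<le> norm l * (K * \<theta> ^ i * S) + A * \<theta> ^ i * S"
    using Suc y[of i] by (intro add_mono mult_left_mono) (auto simp: K_def)
  also have "\<dots> = (norm l * K + A) * (\<theta> ^ i * S)" by (simp add: algebra_simps)
  also have "\<dots> \<le> (\<theta> * K) * (\<theta> ^ i * S)"
    using K_step S \<theta> by (intro mult_right_mono) auto
  finally show ?case by (simp add: K_def mult_ac)
qed

text \<open>
  The recurrence is required only where it involves entries with index below \<open>N\<close>, because the
  sequences of interest are finite; passing from \<open>x\<close> to \<open>(E - \<lambda>) x\<close> costs one index and one degree.
  In degree 0 the recurrence itself says \<open>x i = 0\<close>, in accordance with the empty sum.
\<close>

lemma recurrence_decay:
  fixes p :: "complex poly"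
  assumes "p \<noteq> 0" and "\<And>z. poly p z = 0 \<Longrightarrow> norm z < \<theta>"
  shows "\<exists>C>0. \<forall>N x. (\<forall>n. n + degree p < N \<longrightarrow> shift_op p x n = 0) \<longrightarrow>
           (\<forall>i<N. norm (x i) \<le> C * \<theta> ^ i * (\<Sum>j<degree p. norm (x j)))"
  using assms
proof (induction "degree p" arbitrary: p)
  case 0
  then obtain c where "p = [:c:]" "c \<noteq> 0" by (metis degree_eq_zeroE pCons_0_0)
  then show ?case by (intro exI[of _ 1]) (simp add: shift_op_def)
next
  case (Suc D)
  have "\<not> constant (poly p)" using Suc.hyps(2) by (simp add: constant_degree)
  then obtain l where root: "poly p l = 0" using fundamental_theorem_of_algebra by blast
  then obtain q where p: "p = [:- l, 1:] * q" by (metis poly_eq_0_iff_dvd dvd_def)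
  have "q \<noteq> 0" using Suc.prems(1) p by auto
  then have "degree p = Suc (degree q)"
    unfolding p by (subst degree_mult_eq) auto
  then have degq: "degree q = D" using Suc.hyps(2) by simp
  have l: "norm l < \<theta>" using Suc.prems(2) root by blast
  have "\<And>z. poly q z = 0 \<Longrightarrow> norm z < \<theta>" using Suc.prems(2) p by simp
  then obtain C where C: "C > 0" and decay: "\<And>N y. (\<forall>n. n + D < N \<longrightarrow> shift_op q y n = 0) \<Longrightarrow>
      (\<forall>i<N. norm (y i) \<le> C * \<theta> ^ i * (\<Sum>j<D. norm (y j)))"
    using Suc.hyps(1)[OF degq[symmetric] \<open>q \<noteq> 0\<close>] degq by auto
  \<comment> \<open>The factor \<open>1 + \<bar>l\<bar>\<close> bounds the initial values of \<open>y = (E - l) x\<close> by those of \<open>x\<close>.\<close>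
  define A where "A = C * (1 + norm l)"
  have A: "A \<ge> 0" using C by (simp add: A_def)
  have \<theta>: "\<theta> \<ge> 0" using l norm_ge_zero[of l] by linarith
  show ?case
  proof (intro exI conjI allI impI)
    show "1 + A / (\<theta> - norm l) > 0" using A l by (simp add: add_pos_nonneg)
  next
    fix N x i
    assume rec: "\<forall>n. n + degree p < N \<longrightarrow> shift_op p x n = 0" and i: "i < N"
    define y where "y = (\<lambda>n. x (Suc n) - l * x n)"
    define S where "S = (\<Sum>j<degree p. norm (x j))"
    have "\<forall>n. n + D < N - 1 \<longrightarrow> shift_op q y n = 0"
    proof (intro allI impI)
      fix n assume "n + D < N - 1"
      then have "shift_op p x n = 0" using rec Suc.hyps(2)
        by (metis add_Suc_right less_diff_conv Suc_eq_plus1)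
      then show "shift_op q y n = 0" unfolding p shift_op_linear_factor y_def .
    qed
    note y_decay = decay[OF this]
    have "(\<Sum>j<D. norm (y j)) \<le> (\<Sum>j<D. norm (x (Suc j)) + norm l * norm (x j))"
      unfolding y_def by (intro sum_mono) (metis norm_mult norm_triangle_ineq4)
    also have "\<dots> = (\<Sum>j<D. norm (x (Suc j))) + norm l * (\<Sum>j<D. norm (x j))"
      by (simp add: sum.distrib sum_distrib_left)
    also have "\<dots> \<le> S + norm l * S"
    proof (intro add_mono mult_left_mono)
      show "(\<Sum>j<D. norm (x (Suc j))) \<le> S"
        unfolding S_def Suc.hyps(2)[symmetric] by (subst sum.lessThan_Suc_shift) simp
      show "(\<Sum>j<D. norm (x j)) \<le> S"
        unfolding S_def Suc.hyps(2)[symmetric] by simp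
    qed simp
    finally have y_start: "(\<Sum>j<D. norm (y j)) \<le> (1 + norm l) * S" by (simp add: algebra_simps)
    show "norm (x i) \<le> (1 + A / (\<theta> - norm l)) * \<theta> ^ i * (\<Sum>j<degree p. norm (x j))"
      unfolding S_def[symmetric]
    proof (rule first_order_decay[OF l A _ _ i])
      show "norm (x 0) \<le> S"
        unfolding S_def using Suc.hyps(2) by (intro member_le_sum) auto
    next
      fix k assume "Suc k < N"
      then have "norm (y k) \<le> C * \<theta> ^ k * (\<Sum>j<D. norm (y j))" using y_decay by simp
      also have "\<dots> \<le> C * \<theta> ^ k * ((1 + norm l) * S)"
        using y_start C \<theta> by (intro mult_left_mono) auto
      finally show "norm (x (Suc k) - l * x k) \<le> A * \<theta> ^ k * S"
        by (simp add: A_def y_def mult_ac)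
    qed
  qed
qed

section \<open>The Adams--Bashforth recurrence\<close>

text \<open>
  The factors of the integrand defining \<open>\<beta>\<^sub>1\<close> are \<open>u + i\<close> with \<open>i \<ge> 1\<close>, hence at least 1 on the unit
  interval.
\<close>

lemma AB_coeff_1_pos: "AB_coeff M 1 > 0"
proof -
  let ?f = "\<lambda>u::real. \<Prod>i\<in>{0..<M} - {0}. u + real i"
  have "?f integrable_on {0..1}"
    by (intro integrable_continuous_real continuous_intros)
  then have "integral {0..1} (\<lambda>u::real. 1) \<le> integral {0..1} ?f"
    by (intro integral_le) (auto intro!: prod_ge_1)
  then have "integral {0..1} ?f > 0" by simp
  then show ?thesis by (simp add: AB_coeff_def)
qed

lemma coeff_AB_poly:
  "coeff (AB_poly M) k = (if k < M then complex_of_real (AB_coeff M (M - k)) else 0)"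
proof -
  have "coeff (AB_poly M) k =
      (\<Sum>m = 1..M. if m = M - k \<and> k < M then complex_of_real (AB_coeff M m) else 0)"
    unfolding AB_poly_def coeff_sum by (intro sum.cong) auto
  also have "\<dots> = (if k < M then complex_of_real (AB_coeff M (M - k)) else 0)"
    by (cases "k < M") auto
  finally show ?thesis .
qed

lemma degree_AB_poly:
  assumes "M \<ge> 1"
  shows "degree (AB_poly M) = M - 1"
proof (rule antisym)
  show "degree (AB_poly M) \<le> M - 1" by (rule degree_le) (auto simp: coeff_AB_poly)
  show "M - 1 \<le> degree (AB_poly M)"
    using assms AB_coeff_1_pos[of M] by (intro le_degree) (simp add: coeff_AB_poly)
qed

lemma AB_poly_nonzero:
  assumes "M \<ge> 1"
  shows "AB_poly M \<noteq> 0"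
proof
  assume "AB_poly M = 0"
  then have "coeff (AB_poly M) (M - 1) = 0" by simp
  then show False using assms AB_coeff_1_pos[of M] by (simp add: coeff_AB_poly)
qed

lemma norm_root_le_AB_rho:
  assumes "M \<ge> 1" "poly (AB_poly M) z = 0"
  shows "cmod z \<le> AB_rho M"
proof -
  have "finite {z. poly (AB_poly M) z = 0}"
    using AB_poly_nonzero[OF assms(1)] by (rule poly_roots_finite)
  then have "finite {cmod z | z. poly (AB_poly M) z = 0}" by simp
  then show ?thesis unfolding AB_rho_def using assms(2) by (intro Max_ge) auto
qed

text \<open>
  The polynomial lists the coefficients backwards: \<open>\<beta>\<^sub>m\<close> belongs to \<open>z\<^bsup>M - m\<^esup>\<close>.  So
  the row for the grid point \<open>n + M\<close> is the shift recurrence at \<open>n\<close>.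
\<close>

lemma kernel_recurrence:
  assumes "1 \<le> M" "M \<le> N" "d \<in> mat_kernel (AB_matrix M N)" "n + degree (AB_poly M) < N"
  shows "shift_op (AB_poly M) (\<lambda>i. complex_of_real (d $ i)) n = 0"
proof -
  have dim: "d \<in> carrier_vec N" and ker: "AB_matrix M N *\<^sub>v d = 0\<^sub>v (N - M + 1)"
    using assms(3) by (auto simp: mat_kernel_def AB_matrix_def)
  have n: "n + M \<in> {M..N}" using assms degree_AB_poly[of M] by auto
  have "shift_op (AB_poly M) (\<lambda>i. complex_of_real (d $ i)) n =
      (\<Sum>k\<le>M - 1. complex_of_real (AB_coeff M (M - k) * d $ (n + k)))"
    using assms(1) by (auto simp: shift_op_def degree_AB_poly coeff_AB_poly intro!: sum.cong)
  also have "\<dots> = (\<Sum>m = 1..M. complex_of_real (AB_coeff M m * d $ (n + M - m)))"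
    using assms(1) by (intro sum.reindex_bij_witness[of _ "\<lambda>m. M - m" "\<lambda>k. M - k"]) auto
  also have "\<dots> = complex_of_real (vec_index (AB_matrix M N *\<^sub>v d) (n + M - M))"
    unfolding AB_matrix_mult_vec[OF assms(2) dim n] by simp
  also have "\<dots> = 0"
    unfolding ker using n assms(2) by auto
  finally show ?thesis .
qed

lemma kernel_decay:
  assumes M: "M \<ge> 1" and roots: "\<And>z. poly (AB_poly M) z = 0 \<Longrightarrow> cmod z < \<theta>"
  shows "\<exists>C>0. \<forall>N\<ge>M. \<forall>d\<in>mat_kernel (AB_matrix M N). \<forall>i<N.
           \<bar>d $ i\<bar> \<le> C * \<theta> ^ i * (\<Sum>j<M - 1. \<bar>d $ j\<bar>)"
proof -
  obtain C where C: "C > 0" and decay: "\<And>N x.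
      (\<forall>n. n + degree (AB_poly M) < N \<longrightarrow> shift_op (AB_poly M) x n = 0) \<Longrightarrow>
      (\<forall>i<N. norm (x i) \<le> C * \<theta> ^ i * (\<Sum>j<M - 1. norm (x j)))"
    using recurrence_decay[OF AB_poly_nonzero[OF M] roots] degree_AB_poly[OF M] by auto
  have "\<bar>d $ i\<bar> \<le> C * \<theta> ^ i * (\<Sum>j<M - 1. \<bar>d $ j\<bar>)"
    if "N \<ge> M" "d \<in> mat_kernel (AB_matrix M N)" "i < N" for N d i
    using decay[of N "\<lambda>i. complex_of_real (d $ i)"] kernel_recurrence[OF M that(1,2)] that(3)
    by simp
  then show ?thesis using C by blast
qed

text \<open>
  The one-step scheme has a constant characteristic polynomial, hence no roots, and the decay estimate
  degenerates to \<open>d = 0\<close>: its right-hand side is an empty sum.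
\<close>

lemma kernel_trivial_one_step:
  assumes "N \<ge> 1"
  shows "mat_kernel (AB_matrix 1 N) = {0\<^sub>v N}"
proof
  obtain c where "AB_poly 1 = [:c:]" "c \<noteq> 0"
    using degree_AB_poly[of 1] AB_poly_nonzero[of 1] by (auto elim: degree_eq_zeroE)
  then have no_root: "poly (AB_poly 1) z \<noteq> 0" for z by simp
  have "d = 0\<^sub>v N" if d: "d \<in> mat_kernel (AB_matrix 1 N)" for d
  proof -
    have "\<forall>i<N. \<bar>d $ i\<bar> \<le> 0"
      using kernel_decay[of 1 1] no_root assms d by auto
    moreover have "dim_vec d = N" using d assms by (auto simp: mat_kernel_def AB_matrix_def)
    ultimately show ?thesis by (intro eq_vecI) auto
  qed
  then show "mat_kernel (AB_matrix 1 N) \<subseteq> {0\<^sub>v N}" by blast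
  show "{0\<^sub>v N} \<subseteq> mat_kernel (AB_matrix 1 N)"
    by (auto simp: mat_kernel_def AB_matrix_def intro!: eq_vecI)
qed

theorem theorem3p2:
  fixes M :: nat
  assumes "M \<ge> 1"
  shows "(M = 1 \<longrightarrow> (\<forall>N\<ge>M. mat_kernel (AB_matrix M N) = {0\<^sub>v N})) \<and>
         (M \<ge> 2 \<and> AB_rho M < 1 \<longrightarrow>
           (\<forall>\<theta>\<in>{AB_rho M<..<1}. \<exists>C>0. \<forall>N\<ge>M. \<forall>d\<in>mat_kernel (AB_matrix M N). \<forall>i<N.
              \<bar>d $ i\<bar> \<le> C * \<theta> ^ i * (\<Sum>j = 0..M - 2. \<bar>d $ j\<bar>)))"
proof (intro conjI impI ballI)
  show "\<forall>N\<ge>M. mat_kernel (AB_matrix M N) = {0\<^sub>v N}" if "M = 1"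
    using that kernel_trivial_one_step by blast
next
  fix \<theta> assume M2: "M \<ge> 2 \<and> AB_rho M < 1" and \<theta>: "\<theta> \<in> {AB_rho M<..<1}"
  have "cmod z < \<theta>" if "poly (AB_poly M) z = 0" for z
    using norm_root_le_AB_rho[OF assms that] \<theta> by auto
  moreover have "{..<M - 1} = {0..M - 2}" using M2 by auto
  ultimately show "\<exists>C>0. \<forall>N\<ge>M. \<forall>d\<in>mat_kernel (AB_matrix M N). \<forall>i<N.
      \<bar>d $ i\<bar> \<le> C * \<theta> ^ i * (\<Sum>j = 0..M - 2. \<bar>d $ j\<bar>)"
    using kernel_decay[OF assms, of \<theta>] by simp
qed

end
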